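(* Let $k$ be a positive integer and let $G$ be a connected graph of order $n$ that contains $k$ independent (pairwise non-adjacent, distinct) vertices. Then $$rc(G)\leq 3k\,\frac{n-2}{\sigma_k(G)+k}+6k-4.$$
   Context: All graphs are finite, undirected and simple; the order of a graph is its number of vertices. An edge-coloring of $G$ is any map from $E(G)$ to a finite set of colors (adjacent edges may receive the same color). Given an edge-coloring, $G$ is rainbow edge-connected if for every pair of distinct vertices $u,v$ of $G$ there is a $u$-$v$ path in $G$ whose edges all have distinct colors. For a connected graph $G$, the rainbow connection number $rc(G)$ is the minimum number of colors in an edge-coloring of $G$ that makes $G$ rainbow edge-connected. For a graph $G$ containing $k$ independent vertices, $\sigma_k(G)$ is the minimum of $d(u_1)+d(u_2)+\cdots+d(u_k)$ over all sets of $k$ distinct pairwise non-adjacent vertices $u_1,\dots,u_k$ of $G$, where $d(u)$ denotes the degree of $u$ in $G$.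
   Formalization: The order n is assumed to be at least 2; this excludes only the one-vertex graph, for which k = 1, σ_1 = 0 and the stated bound equals −1 while rc = 0, so the claim fails there. *)

theory Defs
  imports Complex_Main
begin

text \<open>A graph is a pair of a vertex set \<open>V\<close> and a set \<open>E\<close> of two-element subsets of \<open>V\<close>.\<close>

definition simple_graph :: "'a set \<Rightarrow> 'a set set \<Rightarrow> bool" where
  "simple_graph V E \<longleftrightarrow> finite V \<and> E \<subseteq> {{u, v} | u v. u \<in> V \<and> v \<in> V \<and> u \<noteq> v}"

definition degree :: "'a set set \<Rightarrow> 'a \<Rightarrow> nat" where
  "degree E v = card {e \<in> E. v \<in> e}"

fun path_edges :: "'a list \<Rightarrow> 'a set list" where
  "path_edges (x # y # xs) = {x, y} # path_edges (y # xs)"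
| "path_edges _ = []"

definition is_path :: "'a set \<Rightarrow> 'a set set \<Rightarrow> 'a \<Rightarrow> 'a list \<Rightarrow> 'a \<Rightarrow> bool" where
  "is_path V E u p v \<longleftrightarrow>
     p \<noteq> [] \<and> hd p = u \<and> last p = v \<and> distinct p \<and> set p \<subseteq> V \<and> set (path_edges p) \<subseteq> E"

definition connected_graph :: "'a set \<Rightarrow> 'a set set \<Rightarrow> bool" where
  "connected_graph V E \<longleftrightarrow> V \<noteq> {} \<and> (\<forall>u\<in>V. \<forall>v\<in>V. \<exists>p. is_path V E u p v)"

definition rainbow_connected :: "'a set \<Rightarrow> 'a set set \<Rightarrow> ('a set \<Rightarrow> 'c) \<Rightarrow> bool" where
  "rainbow_connected V E c \<longleftrightarrow>
     (\<forall>u\<in>V. \<forall>v\<in>V. u \<noteq> v \<longrightarrow> (\<exists>p. is_path V E u p v \<and> distinct (map c (path_edges p))))"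

text \<open>The colours are taken to be \<open>0, \<dots>, m - 1\<close>. For a connected graph the set of
  admissible \<open>m\<close> is nonempty (give all edges distinct colours).\<close>

definition rc :: "'a set \<Rightarrow> 'a set set \<Rightarrow> nat" where
  "rc V E = (LEAST m. \<exists>c :: 'a set \<Rightarrow> nat. c ` E \<subseteq> {..<m} \<and> rainbow_connected V E c)"

definition independent_set :: "'a set \<Rightarrow> 'a set set \<Rightarrow> 'a set \<Rightarrow> bool" where
  "independent_set V E S \<longleftrightarrow> S \<subseteq> V \<and> pairwise (\<lambda>u v. {u, v} \<notin> E) S"

text \<open>Only meaningful when \<open>V\<close> is finite and has an independent subset of size \<open>k\<close>.\<close>

definition sigma :: "nat \<Rightarrow> 'a set \<Rightarrow> 'a set set \<Rightarrow> nat" where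
  "sigma k V E = Min {\<Sum>u\<in>S. degree E u | S. independent_set V E S \<and> card S = k}"

end

theory Submission imports Defs begin

text \<open>Put \<open>s = (sigma k V E + k) / k\<close>. If \<open>s < 3\<close> the bound follows from \<open>rc \<le> n - 1\<close>. Otherwise grow a
  connected set \<open>D\<close>, starting from one vertex, by three kinds of steps: move to a vertex at
  distance 3; move to a vertex at distance 2 having only one neighbour in \<open>N[D]\<close>; add a vertex of
  \<open>N[D] - D\<close> having only one neighbour in \<open>N[D]\<close>. The vertices reached by the first two kinds
  of steps are independent, and so are those added by the third kind, so averaging \<open>sigma\<close> over them
  bounds \<open>|N[D]|\<close> from below in terms of \<open>|D|\<close>. In the end every vertex outside \<open>D\<close> has two
  neighbours in \<open>N[D]\<close>, so that three colours besides the at most \<open>|D| - 1\<close> used on \<open>D\<close> connect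
  \<open>N[D]\<close>, and two further colours reach the rest. One colour, or none, is enough if at most one
  vertex is left, and this makes the case \<open>k = 1\<close> work.\<close>

section \<open>Neighbourhoods of vertices and of sets\<close>

definition nbrs :: "'a set set \<Rightarrow> 'a \<Rightarrow> 'a set" where
  "nbrs E v = {w. {v, w} \<in> E}"

definition closed_nbhd :: "'a set set \<Rightarrow> 'a set \<Rightarrow> 'a set" where
  "closed_nbhd E D = D \<union> (\<Union>v\<in>D. nbrs E v)"

lemma nbrs_sym: "v \<in> nbrs E w \<longleftrightarrow> w \<in> nbrs E v"
  by (simp add: nbrs_def insert_commute)

lemma closed_nbhd_mono: "D \<subseteq> D' \<Longrightarrow> closed_nbhd E D \<subseteq> closed_nbhd E D'"
  by (auto simp: closed_nbhd_def)

lemma closed_nbhd_superset: "D \<subseteq> closed_nbhd E D"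
  by (auto simp: closed_nbhd_def)

lemma closed_nbhd_notin: "v \<notin> closed_nbhd E D \<Longrightarrow> w \<in> D \<Longrightarrow> w \<notin> nbrs E v"
  using nbrs_sym by (fastforce simp: closed_nbhd_def)

lemma closed_nbhdE:
  assumes "v \<in> closed_nbhd E D" "v \<notin> D"
  obtains w where "w \<in> D" "w \<in> nbrs E v"
  using assms nbrs_sym by (fastforce simp: closed_nbhd_def)

lemma two_elements:
  assumes "card A \<ge> 2"
  obtains a b where "a \<in> A" "b \<in> A" "a \<noteq> b"
  by (metis Suc_leI assms card_2_iff' obtain_subset_with_card_n subsetD)

lemma two_nbrs_transfer:
  assumes "finite B" "card (A \<inter> B) \<ge> 2" "B \<subseteq> C" "finite C"
  shows "card (A \<inter> C) \<ge> 2"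
  using card_mono[of "A \<inter> C" "A \<inter> B"] assms by fastforce

subsection \<open>Rainbow walks\<close>

text \<open>Walks may repeat vertices, and the index \<open>C\<close> is the exact set of colours
  used, so concatenation only asks for disjoint colour sets. \<open>rainbow_walk_path\<close>
  returns to paths at the end.\<close>

inductive rainbow_walk ::
  "'a set \<Rightarrow> 'a set set \<Rightarrow> ('a set \<Rightarrow> 'c) \<Rightarrow> 'a \<Rightarrow> 'c set \<Rightarrow> 'a \<Rightarrow> bool"
  for W :: "'a set" and E :: "'a set set" and c :: "'a set \<Rightarrow> 'c" where
  refl: "u \<in> W \<Longrightarrow> rainbow_walk W E c u {} u"
| step: "u \<in> W \<Longrightarrow> {u, w} \<in> E \<Longrightarrow> rainbow_walk W E c w C v \<Longrightarrow> c {u, w} \<notin> C \<Longrightarrow>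
    rainbow_walk W E c u (insert (c {u, w}) C) v"

lemma rainbow_walk_in: "rainbow_walk W E c u C v \<Longrightarrow> u \<in> W \<and> v \<in> W"
  by (induction rule: rainbow_walk.induct) auto

lemma rainbow_walk_edge:
  assumes "u \<in> W" "v \<in> W" "{u, v} \<in> E"
  shows "rainbow_walk W E c u {c {u, v}} v"
  using rainbow_walk.step[OF assms(1,3) rainbow_walk.refl[OF assms(2)]] by simp

lemma rainbow_walk_trans:
  assumes "rainbow_walk W E c u C v" "rainbow_walk W E c v C' w" "C \<inter> C' = {}"
  shows "rainbow_walk W E c u (C \<union> C') w"
  using assms
proof (induction rule: rainbow_walk.induct)
  case (step u x C v)
  then have "rainbow_walk W E c x (C \<union> C') w" by auto
  from rainbow_walk.step[OF step.hyps(1,2) this] step.hyps(4) step.prems(2)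
  show ?case by auto
qed simp

lemma rainbow_walk_sym: "rainbow_walk W E c u C v \<Longrightarrow> rainbow_walk W E c v C u"
proof (induction rule: rainbow_walk.induct)
  case (step u w C v)
  have "w \<in> W" using rainbow_walk_in[OF step.hyps(3)] by blast
  moreover have "{w, u} \<in> E" using step.hyps(2) by (simp add: insert_commute)
  ultimately have "rainbow_walk W E c w {c {w, u}} u"
    using rainbow_walk_edge step.hyps(1) by metis
  from rainbow_walk_trans[OF step.IH this] step.hyps(4) show ?case
    by (simp add: insert_commute)
qed (rule rainbow_walk.refl)

text \<open>Recolouring is harmless on edges not inside \<open>W\<close> and on edges whose colour
  is outside \<open>C\<close>, since the walk uses neither. The extension lemmas below carry old
  walks into a larger set in this way.\<close>

lemma rainbow_walk_transfer:
  assumes "rainbow_walk W E c u C v" "W \<subseteq> W'"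
    and "\<And>e. e \<subseteq> W \<Longrightarrow> c e \<in> C \<Longrightarrow> c' e = c e"
  shows "rainbow_walk W' E c' u C v"
  using assms(1,3)
proof (induction rule: rainbow_walk.induct)
  case (refl u)
  then show ?case using assms(2) by (auto intro: rainbow_walk.refl)
next
  case (step u w C v)
  have "c' {u, w} = c {u, w}"
    using step.hyps step.prems[of "{u, w}"] rainbow_walk_in by fastforce
  moreover have "rainbow_walk W' E c' w C v"
    using step.IH step.prems by auto
  ultimately show ?case
    using rainbow_walk.step[of u W' w E c' C v] step.hyps assms(2) by auto
qed

lemma path_edges_append:
  "path_edges (xs @ y # ys) = path_edges (xs @ [y]) @ path_edges (y # ys)"
  by (induction xs rule: path_edges.induct) auto

text \<open>The induction prepends one edge at a time; if the new endpoint \<open>u\<close> already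
  lies on the path, the part before \<open>u\<close> is cut off, which can only lose
  colours.\<close>

lemma rainbow_walk_path:
  assumes "rainbow_walk W E c u C v"
  shows "\<exists>p. is_path W E u p v \<and> distinct (map c (path_edges p)) \<and>
    c ` set (path_edges p) \<subseteq> C"
  using assms
proof (induction rule: rainbow_walk.induct)
  case (refl u)
  then show ?case by (intro exI[of _ "[u]"]) (auto simp: is_path_def)
next
  case (step u w C v)
  then obtain p where p: "is_path W E w p v" "distinct (map c (path_edges p))"
    "c ` set (path_edges p) \<subseteq> C" by blast
  show ?case
  proof (cases "u \<in> set p")
    case True
    then obtain xs ys where xs: "p = xs @ u # ys" by (meson split_list)
    have "is_path W E u (u # ys) v"
      using p(1) path_edges_append[of xs u ys] by (auto simp: is_path_def xs)
    moreover have "distinct (map c (path_edges (u # ys)))"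
      "c ` set (path_edges (u # ys)) \<subseteq> C"
      using p(2,3) path_edges_append[of xs u ys] by (auto simp: xs)
    ultimately show ?thesis by blast
  next
    case False
    obtain ys where ys: "p = w # ys" using p(1) by (cases p) (auto simp: is_path_def)
    have "is_path W E u (u # p) v"
      using p(1) False step.hyps by (auto simp: is_path_def ys)
    moreover have "distinct (map c (path_edges (u # p)))"
      "c ` set (path_edges (u # p)) \<subseteq> insert (c {u, w}) C"
      using p(2,3) step.hyps(4) by (auto simp: ys)
    ultimately show ?thesis by blast
  qed
qed

text \<open>Only the edges of the chosen walks are confined to colours below \<open>r\<close>; all
  others may carry any number, so the extension lemmas can ignore them.\<close>

definition rainbow_colourable :: "'a set \<Rightarrow> 'a set set \<Rightarrow> nat \<Rightarrow> bool" where
  "rainbow_colourable W E r \<longleftrightarrow>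
    (\<exists>c. \<forall>u\<in>W. \<forall>v\<in>W. \<exists>C. rainbow_walk W E c u C v \<and> C \<subseteq> {..<r})"

lemma rc_le_rainbow_colourable:
  assumes "rainbow_colourable V E r" "r > 0"
  shows "rc V E \<le> r"
proof -
  obtain c where c: "\<And>u v. u \<in> V \<Longrightarrow> v \<in> V \<Longrightarrow>
      \<exists>C. rainbow_walk V E c u C v \<and> C \<subseteq> {..<r}"
    using assms(1) unfolding rainbow_colourable_def by blast
  \<comment> \<open>Colours out of range become 0. The chosen walks avoid such edges, and 0 is in
    range because \<open>r > 0\<close>.\<close>
  define c' where "c' e = (if c e < r then c e else 0)" for e
  have "\<exists>p. is_path V E u p v \<and> distinct (map c' (path_edges p))"
    if uv: "u \<in> V" "v \<in> V" for u v
  proof -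
    obtain C where C: "rainbow_walk V E c u C v" "C \<subseteq> {..<r}" using c uv by blast
    have "rainbow_walk V E c' u C v"
      by (rule rainbow_walk_transfer[OF C(1)]) (use C(2) in \<open>auto simp: c'_def\<close>)
    from rainbow_walk_path[OF this] show ?thesis by blast
  qed
  moreover have "c' ` E \<subseteq> {..<r}" using assms(2) by (auto simp: c'_def)
  ultimately have "c' ` E \<subseteq> {..<r} \<and> rainbow_connected V E c'"
    by (auto simp: rainbow_connected_def)
  then show ?thesis unfolding rc_def by (intro Least_le) blast
qed

subsection \<open>Extending a rainbow coloring\<close>

text \<open>A walk between \<open>v\<close> and \<open>W\<close> needs only the edge
  \<open>{v, w}\<close> at \<open>v\<close>, so one fresh colour \<open>r\<close> suffices; edges
  inside \<open>W\<close> do not contain \<open>v\<close> and keep their colours.\<close>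

lemma rainbow_colourable_insert:
  assumes "rainbow_colourable W E r" "v \<notin> W" "w \<in> W" "w \<in> nbrs E v"
  shows "rainbow_colourable (insert v W) E (r + 1)"
proof -
  obtain c where c: "\<And>u v. u \<in> W \<Longrightarrow> v \<in> W \<Longrightarrow>
      \<exists>C. rainbow_walk W E c u C v \<and> C \<subseteq> {..<r}"
    using assms(1) unfolding rainbow_colourable_def by blast
  define c' where "c' e = (if v \<in> e then r else c e)" for e
  have old: "\<exists>C. rainbow_walk (insert v W) E c' a C b \<and> C \<subseteq> {..<r}"
    if ab: "a \<in> W" "b \<in> W" for a b
  proof -
    obtain C where C: "rainbow_walk W E c a C b" "C \<subseteq> {..<r}" using c ab by blast
    have "rainbow_walk (insert v W) E c' a C b"
      by (rule rainbow_walk_transfer[OF C(1)]) (use assms(2) in \<open>auto simp: c'_def\<close>)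
    with C(2) show ?thesis by blast
  qed
  have new: "\<exists>C. rainbow_walk (insert v W) E c' v C b \<and> C \<subseteq> {..<r + 1}"
    if b: "b \<in> W" for b
  proof -
    obtain C where C: "rainbow_walk (insert v W) E c' w C b" "C \<subseteq> {..<r}"
      using old assms(3) b by blast
    have vw: "{v, w} \<in> E" "c' {v, w} = r" using assms(4) by (auto simp: nbrs_def c'_def)
    have "rainbow_walk (insert v W) E c' v (insert (c' {v, w}) C) b"
      by (rule rainbow_walk.step) (use C vw in auto)
    then show ?thesis using C(2) vw(2) by (intro exI[of _ "insert r C"]) auto
  qed
  have "\<exists>C. rainbow_walk (insert v W) E c' a C b \<and> C \<subseteq> {..<r + 1}"
    if ab: "a \<in> insert v W" "b \<in> insert v W" for a b
  proof -
    consider "a \<in> W" "b \<in> W" | "a = v" "b = v" | "a = v" "b \<in> W" | "a \<in> W" "b = v"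
      using ab by blast
    then show ?thesis
    proof cases
      case 1
      then obtain C where "rainbow_walk (insert v W) E c' a C b" "C \<subseteq> {..<r}"
        using old by blast
      then show ?thesis by (intro exI[of _ C]) auto
    next
      case 2
      then show ?thesis by (intro exI[of _ "{}"]) (auto intro: rainbow_walk.refl)
    next
      case 3
      then show ?thesis using new by blast
    next
      case 4
      then show ?thesis using new rainbow_walk_sym by meson
    qed
  qed
  then show ?thesis unfolding rainbow_colourable_def by blast
qed

text \<open>Every new vertex has an edge of colour \<open>r\<close> and one of colour \<open>r + 1\<close> into \<open>W\<close>, so two new
  vertices can always enter \<open>W\<close> with different colours.\<close>

lemma rainbow_colourable_two_nbrs:
  assumes "rainbow_colourable W E r" "W \<inter> Z = {}"
    and "\<And>z. z \<in> Z \<Longrightarrow> card (nbrs E z \<inter> W) \<ge> 2"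
  shows "rainbow_colourable (W \<union> Z) E (r + 2)"
proof -
  obtain c where c: "\<And>u v. u \<in> W \<Longrightarrow> v \<in> W \<Longrightarrow>
      \<exists>C. rainbow_walk W E c u C v \<and> C \<subseteq> {..<r}"
    using assms(1) unfolding rainbow_colourable_def by blast
  have "\<forall>z\<in>Z. \<exists>a b. a \<in> nbrs E z \<inter> W \<and> b \<in> nbrs E z \<inter> W \<and> a \<noteq> b"
    using assms(3) two_elements by metis
  then obtain f g where fg: "\<And>z. z \<in> Z \<Longrightarrow> f z \<in> nbrs E z \<inter> W"
    "\<And>z. z \<in> Z \<Longrightarrow> g z \<in> nbrs E z \<inter> W" "\<And>z. z \<in> Z \<Longrightarrow> f z \<noteq> g z"
    by metis
  define c' where "c' e = (if \<exists>z\<in>Z. e = {z, f z} then r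
    else if \<exists>z\<in>Z. e = {z, g z} then r + 1 else c e)" for e
  let ?U = "W \<union> Z"
  have old: "\<exists>C. rainbow_walk ?U E c' a C b \<and> C \<subseteq> {..<r}" if ab: "a \<in> W" "b \<in> W" for a b
  proof -
    obtain C where C: "rainbow_walk W E c a C b" "C \<subseteq> {..<r}" using c ab by blast
    have "rainbow_walk ?U E c' a C b"
      by (rule rainbow_walk_transfer[OF C(1)]) (use assms(2) in \<open>auto simp: c'_def\<close>)
    with C(2) show ?thesis by blast
  qed
  have f: "rainbow_walk ?U E c' z {r} (f z)" if "z \<in> Z" for z
  proof -
    have "c' {z, f z} = r" using that by (auto simp: c'_def)
    then show ?thesis using rainbow_walk_edge[of z ?U "f z" E c'] fg(1)[OF that] that
      by (auto simp: nbrs_def)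
  qed
  have g: "rainbow_walk ?U E c' z {r + 1} (g z)" if "z \<in> Z" for z
  proof -
    \<comment> \<open>The clause for \<open>f\<close> comes first in \<open>c'\<close>, so the edge
      to \<open>g z\<close> must avoid it; as \<open>W\<close> and \<open>Z\<close> are disjoint, a
      clash would force \<open>f z = g z\<close>.\<close>
    have "{z, g z} \<noteq> {y, f y}" if "y \<in> Z" for y
    proof
      assume eq: "{z, g z} = {y, f y}"
      have "g z \<notin> Z" "f y \<notin> Z" using fg(1)[OF that] fg(2)[OF \<open>z \<in> Z\<close>] assms(2) by auto
      then have "z = y" "g z = f y" using eq that \<open>z \<in> Z\<close> by (auto simp: doubleton_eq_iff)
      then show False using fg(3)[OF that] by simp
    qed
    then have "c' {z, g z} = r + 1" using that by (auto simp: c'_def)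
    then show ?thesis using rainbow_walk_edge[of z ?U "g z" E c'] fg(2)[OF that] that
      by (auto simp: nbrs_def)
  qed
  have mixed: "\<exists>C. rainbow_walk ?U E c' a C b \<and> C \<subseteq> {..<r + 2}" if ab: "a \<in> Z" "b \<in> W" for a b
  proof -
    obtain C where C: "rainbow_walk ?U E c' (f a) C b" "C \<subseteq> {..<r}"
      using old fg(1) ab by blast
    then have "rainbow_walk ?U E c' a ({r} \<union> C) b"
      by (intro rainbow_walk_trans[OF f]) (use ab in auto)
    with C(2) show ?thesis by (intro exI[of _ "{r} \<union> C"]) auto
  qed
  have "\<exists>C. rainbow_walk ?U E c' a C b \<and> C \<subseteq> {..<r + 2}"
    if ab: "a \<in> ?U" "b \<in> ?U" for a b
  proof -
    consider "a \<in> W" "b \<in> W" | "a \<in> Z" "b \<in> W" | "a \<in> W" "b \<in> Z" | "a \<in> Z" "b \<in> Z"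
      using ab by blast
    then show ?thesis
    proof cases
      case 1
      then obtain C where "rainbow_walk ?U E c' a C b" "C \<subseteq> {..<r}" using old by blast
      then show ?thesis by (intro exI[of _ C]) auto
    next
      case 2
      then show ?thesis using mixed by blast
    next
      case 3
      then show ?thesis using mixed rainbow_walk_sym by meson
    next
      case 4
      obtain C where C: "rainbow_walk ?U E c' (f a) C (g b)" "C \<subseteq> {..<r}"
        using old[of "f a" "g b"] fg(1)[OF 4(1)] fg(2)[OF 4(2)] by blast
      have "rainbow_walk ?U E c' a ({r} \<union> C) (g b)"
        by (rule rainbow_walk_trans[OF f[OF 4(1)] C(1)]) (use C(2) in auto)
      moreover have "({r} \<union> C) \<inter> {r + 1} = {}" using C(2) by auto
      ultimately have "rainbow_walk ?U E c' a ({r} \<union> C \<union> {r + 1}) b"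
        by (rule rainbow_walk_trans[OF _ rainbow_walk_sym[OF g[OF 4(2)]]])
      then show ?thesis using C(2) by (intro exI[of _ "{r} \<union> C \<union> {r + 1}"]) auto
    qed
  qed
  then show ?thesis unfolding rainbow_colourable_def by blast
qed

lemma maximal_independent_exists:
  assumes "finite X"
  obtains M where "M \<subseteq> X" "\<And>x y. x \<in> M \<Longrightarrow> y \<in> M \<Longrightarrow> x \<noteq> y \<Longrightarrow> y \<notin> nbrs E x"
    "\<And>x. x \<in> X - M \<Longrightarrow> \<exists>y\<in>M. y \<in> nbrs E x"
proof -
  define \<F> where "\<F> = {M. M \<subseteq> X \<and> (\<forall>x\<in>M. \<forall>y\<in>M. x \<noteq> y \<longrightarrow> y \<notin> nbrs E x)}"
  have "finite \<F>" using assms by (auto simp: \<F>_def intro: finite_subset[of _ "Pow X"])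
  moreover have "{} \<in> \<F>" by (simp add: \<F>_def)
  ultimately obtain M where M: "M \<in> \<F>" "\<And>M'. M' \<in> \<F> \<Longrightarrow> M \<subseteq> M' \<Longrightarrow> M = M'"
    using finite_has_maximal[of \<F>] by auto
  have "\<exists>y\<in>M. y \<in> nbrs E x" if x: "x \<in> X - M" for x
  proof (rule ccontr)
    assume none: "\<not> ?thesis"
    then have "x \<notin> nbrs E y" if "y \<in> M" for y using that nbrs_sym[of x E y] by blast
    then have "insert x M \<in> \<F>" using M(1) x none by (auto simp: \<F>_def)
    then show False using M(2)[of "insert x M"] x by blast
  qed
  with M(1) show ?thesis using that unfolding \<F>_def by blast
qed

text \<open>A maximal independent set \<open>M\<close> of the graph induced on \<open>X\<close> splits \<open>X\<close> into two sides. Edges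
  from \<open>M\<close> to \<open>D\<close> get colour \<open>r\<close>, those from \<open>X - M\<close> get \<open>r + 1\<close>, those inside \<open>X\<close> get \<open>r + 2\<close>.
  A vertex of \<open>X\<close> reaches \<open>D\<close> either directly or through a neighbour on the other side; a vertex
  without neighbours in \<open>X\<close> uses a second edge to \<open>D\<close> of the other colour.\<close>

lemma rainbow_colourable_dominated:
  assumes "rainbow_colourable D E r" "finite X" "D \<inter> X = {}"
    and dom: "\<And>x. x \<in> X \<Longrightarrow> nbrs E x \<inter> D \<noteq> {}"
    and two: "\<And>x. x \<in> X \<Longrightarrow> card (nbrs E x \<inter> (D \<union> X)) \<ge> 2"
    and irrefl: "\<And>x. x \<notin> nbrs E x"
  shows "rainbow_colourable (D \<union> X) E (r + 3)"
proof -
  obtain c where c: "\<And>u v. u \<in> D \<Longrightarrow> v \<in> D \<Longrightarrow>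
      \<exists>C. rainbow_walk D E c u C v \<and> C \<subseteq> {..<r}"
    using assms(1) unfolding rainbow_colourable_def by blast
  obtain M where M: "M \<subseteq> X" "\<And>x y. x \<in> M \<Longrightarrow> y \<in> M \<Longrightarrow> x \<noteq> y \<Longrightarrow> y \<notin> nbrs E x"
    "\<And>x. x \<in> X - M \<Longrightarrow> \<exists>y\<in>M. y \<in> nbrs E x"
    using maximal_independent_exists[OF assms(2)] by metis
  \<comment> \<open>A vertex of \<open>X - M\<close> always has a neighbour in \<open>M\<close>, so
    the vertices without neighbours in \<open>X\<close> all lie in \<open>M\<close>.\<close>
  define J where "J = {x \<in> M. nbrs E x \<inter> X = {}}"
  have "\<forall>x. x \<in> X \<longrightarrow> (\<exists>a. a \<in> nbrs E x \<inter> D)" using dom by blast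
  then obtain f where f: "\<And>x. x \<in> X \<Longrightarrow> f x \<in> nbrs E x \<inter> D" by metis
  have "\<exists>b. b \<in> nbrs E x \<inter> D \<and> b \<noteq> f x" if "x \<in> J" for x
  proof -
    have "nbrs E x \<inter> (D \<union> X) = nbrs E x \<inter> D" using that by (auto simp: J_def)
    moreover have "x \<in> X" using that M(1) by (auto simp: J_def)
    ultimately show ?thesis using two[of x] two_elements[of "nbrs E x \<inter> D"] by metis
  qed
  then obtain g where g: "\<And>x. x \<in> J \<Longrightarrow> g x \<in> nbrs E x \<inter> D" "\<And>x. x \<in> J \<Longrightarrow> g x \<noteq> f x"
    by metis
  define c' where "c' e = (if e \<subseteq> D then c e else if e \<subseteq> X then r + 2
    else if (\<exists>x\<in>X - M. e = {x, f x}) \<or> (\<exists>x\<in>J. e = {x, g x}) then r + 1 else r)" for e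
  let ?U = "D \<union> X"
  have old: "\<exists>C. rainbow_walk ?U E c' a C b \<and> C \<subseteq> {..<r}" if ab: "a \<in> D" "b \<in> D" for a b
  proof -
    obtain C where C: "rainbow_walk D E c a C b" "C \<subseteq> {..<r}" using c ab by blast
    have "rainbow_walk ?U E c' a C b"
      by (rule rainbow_walk_transfer[OF C(1)]) (auto simp: c'_def)
    with C(2) show ?thesis by blast
  qed
  have JX: "x \<in> X" if "x \<in> J" for x using that M(1) by (auto simp: J_def)
  have sep: "x = y \<and> a = b" if "{x, a} = {y, b}" "x \<in> X" "y \<in> X" "a \<in> D" "b \<in> D" for x y a b
    using that assms(3) by (auto simp: doubleton_eq_iff)
  have cM: "c' {x, f x} = r" if "x \<in> M" for x
  proof -
    have xX: "x \<in> X" using that M(1) by blast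
    have "{x, f x} \<noteq> {y, f y}" if "y \<in> X - M" for y
      using sep[of x "f x" y "f y"] f[OF xX] f[of y] that \<open>x \<in> M\<close> xX by auto
    moreover have "{x, f x} \<noteq> {y, g y}" if "y \<in> J" for y
      using sep[of x "f x" y "g y"] f[OF xX] g[OF that] JX[OF that] xX by auto
    ultimately show ?thesis using f[OF xX] xX assms(3) by (auto simp: c'_def)
  qed
  have cN: "c' {x, f x} = r + 1" if "x \<in> X - M" for x
    using f[of x] that assms(3) by (auto simp: c'_def)
  have cJ: "c' {x, g x} = r + 1" if "x \<in> J" for x
    using g[OF that] JX[OF that] that assms(3) by (auto simp: c'_def)
  have cX: "c' {x, y} = r + 2" if "x \<in> X" "y \<in> X" for x y
    using that assms(3) by (auto simp: c'_def)
  have wM: "rainbow_walk ?U E c' x {r} (f x)" if "x \<in> M" for x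
    using rainbow_walk_edge[of x ?U "f x" E c'] cM[OF that] f[of x] that M(1)
    by (auto simp: nbrs_def)
  have wN: "rainbow_walk ?U E c' x {r + 1} (f x)" if "x \<in> X - M" for x
    using rainbow_walk_edge[of x ?U "f x" E c'] cN[OF that] f[of x] that
    by (auto simp: nbrs_def)
  \<comment> \<open>A second exit avoiding colour \<open>r\<close>: of two vertices of
    \<open>M\<close>, one takes its direct edge and the other this exit. \<open>wN'\<close> is the
    counterpart avoiding \<open>r + 1\<close>.\<close>
  have wM': "\<exists>C d. rainbow_walk ?U E c' x C d \<and> d \<in> D \<and> C \<subseteq> {r + 1, r + 2}" if "x \<in> M" for x
  proof (cases "x \<in> J")
    case True
    then show ?thesis
      using rainbow_walk_edge[of x ?U "g x" E c'] cJ[OF True] g(1)[OF True] JX[OF True]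
      by (intro exI[of _ "{r + 1}"] exI[of _ "g x"]) (auto simp: nbrs_def)
  next
    case False
    then obtain y where y: "y \<in> X" "y \<in> nbrs E x" using \<open>x \<in> M\<close> by (auto simp: J_def)
    then have yM: "y \<in> X - M" using M(2)[OF that, of y] irrefl[of x] by auto
    have xX: "x \<in> X" using that M(1) by blast
    have "rainbow_walk ?U E c' x {r + 2} y"
      using rainbow_walk_edge[of x ?U y E c'] cX[OF xX y(1)] y xX by (auto simp: nbrs_def)
    from rainbow_walk_trans[OF this wN[OF yM]]
    have "rainbow_walk ?U E c' x ({r + 2} \<union> {r + 1}) (f y)" by simp
    then show ?thesis using f[OF y(1)]
      by (intro exI[of _ "{r + 2} \<union> {r + 1}"] exI[of _ "f y"]) auto
  qed
  have wN': "\<exists>C d. rainbow_walk ?U E c' x C d \<and> d \<in> D \<and> C \<subseteq> {r, r + 2}" if x: "x \<in> X - M" for x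
  proof -
    obtain y where y: "y \<in> M" "y \<in> nbrs E x" using M(3)[OF x] by blast
    have yX: "y \<in> X" using y M(1) by blast
    have "rainbow_walk ?U E c' x {r + 2} y"
      using rainbow_walk_edge[of x ?U y E c'] cX[of x y] y yX x by (auto simp: nbrs_def)
    from rainbow_walk_trans[OF this wM[OF y(1)]]
    have "rainbow_walk ?U E c' x ({r + 2} \<union> {r}) (f y)" by simp
    then show ?thesis using f[OF yX]
      by (intro exI[of _ "{r + 2} \<union> {r}"] exI[of _ "f y"]) auto
  qed
  have join: "\<exists>C. rainbow_walk ?U E c' a C b \<and> C \<subseteq> {..<r + 3}"
    if h: "rainbow_walk ?U E c' a A d" "d \<in> D" "rainbow_walk ?U E c' b B d'" "d' \<in> D"
      "A \<union> B \<subseteq> {r, r + 1, r + 2}" "A \<inter> B = {}" for a b A B d d'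
  proof -
    obtain C where C: "rainbow_walk ?U E c' d C d'" "C \<subseteq> {..<r}" using old h(2,4) by blast
    have "A \<inter> C = {}" using h(5) C(2) by fastforce
    from rainbow_walk_trans[OF h(1) C(1) this]
    have *: "rainbow_walk ?U E c' a (A \<union> C) d'" .
    have "(A \<union> C) \<inter> B = {}" using h(5,6) C(2) by fastforce
    from rainbow_walk_trans[OF * rainbow_walk_sym[OF h(3)] this]
    have "rainbow_walk ?U E c' a (A \<union> C \<union> B) b" .
    moreover have "A \<union> C \<union> B \<subseteq> {..<r + 3}" using h(5) C(2) by fastforce
    ultimately show ?thesis by blast
  qed
  have w0: "rainbow_walk ?U E c' d {} d" if "d \<in> D" for d
    using that by (auto intro: rainbow_walk.refl)
  have fD: "f x \<in> D" if "x \<in> X" for x using f[OF that] by blast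
  \<comment> \<open>\<open>le\<close> orders the three classes as \<open>D\<close>,
    \<open>M\<close>, \<open>X - M\<close>; the reversed pairs follow by symmetry.\<close>
  have half: "\<exists>C. rainbow_walk ?U E c' a C b \<and> C \<subseteq> {..<r + 3}"
    if a: "a \<in> ?U" and b: "b \<in> ?U" and le: "a \<in> D \<or> b \<in> X \<and> (a \<in> M \<or> b \<notin> M)" for a b
  proof -
    consider "a \<in> D" "b \<in> D" | "a \<in> D" "b \<in> M" | "a \<in> D" "b \<in> X - M" | "a \<in> M" "b \<in> M"
      | "a \<in> M" "b \<in> X - M" | "a \<in> X - M" "b \<in> X - M"
      using a b le by blast
    then show ?thesis
    proof cases
      case 1
      then show ?thesis by (intro join[OF w0 _ w0]) auto
    next
      case 2
      then show ?thesis using M(1) by (intro join[OF w0 _ wM fD]) auto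
    next
      case 3
      then show ?thesis by (intro join[OF w0 _ wN fD]) auto
    next
      case 4
      then obtain C d where C: "rainbow_walk ?U E c' b C d" "d \<in> D" "C \<subseteq> {r + 1, r + 2}"
        using wM' by blast
      show ?thesis
        by (rule join[OF wM fD C(1,2)]) (use 4 M(1) C(3) in auto)
    next
      case 5
      then show ?thesis using M(1) by (intro join[OF wM fD wN fD]) auto
    next
      case 6
      then obtain C d where C: "rainbow_walk ?U E c' b C d" "d \<in> D" "C \<subseteq> {r, r + 2}"
        using wN' by blast
      show ?thesis
        by (rule join[OF wN fD C(1,2)]) (use 6 C(3) in auto)
    qed
  qed
  have "\<exists>C. rainbow_walk ?U E c' a C b \<and> C \<subseteq> {..<r + 3}"
    if ab: "a \<in> ?U" "b \<in> ?U" for a b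
  proof (cases "a \<in> D \<or> b \<in> X \<and> (a \<in> M \<or> b \<notin> M)")
    case True
    then show ?thesis using half ab by blast
  next
    case False
    then have "b \<in> D \<or> a \<in> X \<and> (b \<in> M \<or> a \<notin> M)" using ab M(1) by blast
    then show ?thesis using half[OF ab(2,1)] rainbow_walk_sym by meson
  qed
  then show ?thesis unfolding rainbow_colourable_def by blast
qed

text \<open>The vertex sets inducing connected subgraphs, generated by attaching one vertex at a time.\<close>

inductive connected_set :: "'a set set \<Rightarrow> 'a set \<Rightarrow> bool" for E :: "'a set set" where
  singleton: "connected_set E {u}"
| insert: "connected_set E D \<Longrightarrow> v \<notin> D \<Longrightarrow> w \<in> D \<Longrightarrow> w \<in> nbrs E v \<Longrightarrow>
    connected_set E (insert v D)"

lemma connected_set_finite: "connected_set E D \<Longrightarrow> finite D \<and> D \<noteq> {}"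
  by (induction rule: connected_set.induct) auto

text \<open>As in a spanning tree, each vertex attached after the first costs one colour.\<close>

lemma connected_set_colourable:
  "connected_set E D \<Longrightarrow> rainbow_colourable D E (card D - 1)"
proof (induction rule: connected_set.induct)
  case (singleton u)
  show ?case unfolding rainbow_colourable_def
    by (auto intro!: rainbow_walk.refl exI[of _ "{}"])
next
  case (insert D v w)
  have "card (insert v D) - 1 = card D - 1 + 1"
    using insert.hyps connected_set_finite[OF insert.hyps(1)] by (simp add: card_gt_0_iff)
  then show ?case using rainbow_colourable_insert[OF insert.IH insert.hyps(2-4)] by simp
qed

subsection \<open>Averaging degrees over independent sets\<close>

text \<open>Induction on \<open>card S\<close>: the bounds for all \<open>S - {x}\<close> are summed
  over \<open>x\<close>. Each element is counted \<open>card S - 1\<close> times, and this factor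
  cancels because \<open>card S > k \<ge> 1\<close> in the step.\<close>

lemma average_of_subsets:
  fixes h :: "'a \<Rightarrow> nat"
  assumes "finite S" "card S \<ge> k" "k \<ge> 1"
    and "\<And>T. T \<subseteq> S \<Longrightarrow> card T = k \<Longrightarrow> s \<le> sum h T"
  shows "card S * s \<le> k * sum h S"
  using assms(1,2,4)
proof (induction "card S" arbitrary: S rule: less_induct)
  case less
  show ?case
  proof (cases "card S = k")
    case True
    then show ?thesis using less.prems(3)[of S] by simp
  next
    case False
    have IH: "(card S - 1) * s \<le> k * sum h (S - {x})" if x: "x \<in> S" for x
    proof -
      have card: "card (S - {x}) = card S - 1" using x by simp
      have "card (S - {x}) * s \<le> k * sum h (S - {x})"
      proof (rule less.hyps)
        show "card (S - {x}) < card S" using less.prems(1) x by (rule card_Diff1_less)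
        show "k \<le> card (S - {x})" using card False less.prems(2) by simp
      qed (use less.prems(1,3) in auto)
      then show ?thesis using card by simp
    qed
    have "(\<Sum>x\<in>S. sum h (S - {x})) + sum h S = (\<Sum>x\<in>S. sum h (S - {x}) + h x)"
      by (simp add: sum.distrib)
    also have "\<dots> = (\<Sum>x\<in>S. sum h S)"
      by (rule sum.cong) (use less.prems(1) in \<open>auto simp: sum.remove add.commute\<close>)
    finally have total: "(\<Sum>x\<in>S. sum h (S - {x})) + sum h S = card S * sum h S" by simp
    have "card S * ((card S - 1) * s) \<le> (\<Sum>x\<in>S. k * sum h (S - {x}))"
      using sum_mono[of S "\<lambda>_. (card S - 1) * s"] IH by simp
    also have "\<dots> = k * (\<Sum>x\<in>S. sum h (S - {x}))" by (simp add: sum_distrib_left)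
    also have "(\<Sum>x\<in>S. sum h (S - {x})) = (card S - 1) * sum h S"
      using total by (simp add: diff_mult_distrib)
    finally have "(card S - 1) * (card S * s) \<le> (card S - 1) * (k * sum h S)"
      by (simp add: mult.left_commute)
    moreover have "card S - 1 > 0" using False less.prems(2) assms(3) by simp
    ultimately show ?thesis by simp
  qed
qed

locale simple_graph_loc =
  fixes V :: "'a set" and E :: "'a set set"
  assumes simple: "simple_graph V E"
begin

lemma finite_V: "finite V"
  using simple by (simp add: simple_graph_def)

lemma nbrs_subset: "nbrs E v \<subseteq> V"
  using simple by (auto simp: simple_graph_def nbrs_def doubleton_eq_iff)

lemma nbrs_irrefl: "v \<notin> nbrs E v"
  using simple by (fastforce simp: simple_graph_def nbrs_def)

lemma finite_nbrs: "finite (nbrs E v)"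
  using finite_V nbrs_subset finite_subset by blast

lemma degree_nbrs: "degree E v = card (nbrs E v)"
proof -
  have "{e \<in> E. v \<in> e} = (\<lambda>w. {v, w}) ` nbrs E v"
    using simple by (fastforce simp: simple_graph_def nbrs_def insert_commute)
  moreover have "inj_on (\<lambda>w. {v, w}) (nbrs E v)"
    by (auto simp: inj_on_def doubleton_eq_iff)
  ultimately show ?thesis by (simp add: degree_def card_image)
qed

lemma closed_nbhd_subset: "D \<subseteq> V \<Longrightarrow> closed_nbhd E D \<subseteq> V"
  using nbrs_subset by (auto simp: closed_nbhd_def)

lemma finite_closed_nbhd: "D \<subseteq> V \<Longrightarrow> finite (closed_nbhd E D)"
  using closed_nbhd_subset finite_V finite_subset by blast

lemma independent_set_insert:
  assumes "independent_set V E S" "v \<in> V" "S \<inter> nbrs E v = {}"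
  shows "independent_set V E (insert v S)"
  using assms by (auto simp: independent_set_def pairwise_insert nbrs_def insert_commute)

text \<open>Each \<open>k\<close>-subset of \<open>S\<close> is itself independent and so competes
  in the minimum defining \<open>sigma\<close>.\<close>

lemma sigma_average:
  assumes "independent_set V E S" "card S \<ge> k" "k \<ge> 1"
  shows "card S * sigma k V E \<le> k * (\<Sum>u\<in>S. degree E u)"
proof (rule average_of_subsets)
  show "finite S" using assms(1) finite_V finite_subset by (auto simp: independent_set_def)
  fix T assume T: "T \<subseteq> S" "card T = k"
  let ?A = "{\<Sum>u\<in>S. degree E u | S. independent_set V E S \<and> card S = k}"
  have "?A \<subseteq> (\<lambda>S. \<Sum>u\<in>S. degree E u) ` Pow V" by (auto simp: independent_set_def)
  then have "finite ?A" using finite_V finite_subset by blast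
  moreover have "independent_set V E T"
    using T(1) assms(1) by (auto simp: independent_set_def intro: pairwise_subset)
  ultimately show "sigma k V E \<le> (\<Sum>u\<in>T. degree E u)"
    unfolding sigma_def using T(2) by (intro Min_le) auto
qed (use assms in auto)

end

section \<open>Consequences of connectedness\<close>

locale connected_graph_loc = simple_graph_loc +
  assumes conn: "connected_graph V E"
begin

text \<open>The induction follows a path from \<open>D\<close> to its complement up to the first
  edge leaving \<open>D\<close>.\<close>

lemma boundary_edge:
  assumes "D \<subseteq> V" "D \<noteq> {}" "D \<noteq> V"
  obtains u v where "u \<in> D" "v \<in> V - D" "u \<in> nbrs E v"
proof -
  obtain a b where ab: "a \<in> D" "b \<in> V - D" using assms by blast
  then obtain p where "is_path V E a p b"
    using conn assms(1) unfolding connected_graph_def by blast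
  then have "\<exists>u v. u \<in> D \<and> v \<in> V - D \<and> {u, v} \<in> E" using ab(1)
  proof (induction p arbitrary: a)
    case Nil
    then show ?case by (simp add: is_path_def)
  next
    case (Cons x p)
    then have x: "x = a" by (simp add: is_path_def)
    have "p \<noteq> []" using Cons.prems ab(2) by (auto simp: is_path_def)
    then obtain y q where p: "p = y # q" by (cases p) auto
    have e: "{a, y} \<in> E" "y \<in> V" and path: "is_path V E y p b"
      using Cons.prems(1) by (auto simp: is_path_def p x)
    show ?case
    proof (cases "y \<in> D")
      case True
      then show ?thesis using Cons.IH path by blast
    next
      case False
      then show ?thesis using e Cons.prems(2) by blast
    qed
  qed
  then show ?thesis using that by (auto simp: nbrs_def insert_commute)
qed

lemma connected_set_extend:
  "connected_set E D \<Longrightarrow> D \<subseteq> V \<Longrightarrow> connected_set E V"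
proof (induction "card V - card D" arbitrary: D rule: less_induct)
  case less
  show ?case
  proof (cases "D = V")
    case False
    then obtain u v where uv: "u \<in> D" "v \<in> V - D" "u \<in> nbrs E v"
      using boundary_edge less.prems connected_set_finite by metis
    have "card D < card V" using less.prems(2) False finite_V by (simp add: psubset_card_mono psubset_eq)
    moreover have "card (insert v D) = card D + 1"
      using uv connected_set_finite[OF less.prems(1)] by simp
    ultimately show ?thesis
      using less.hyps[of "insert v D"] connected_set.insert[OF less.prems(1) _ uv(1,3)] uv(2) less.prems(2)
      by auto
  qed (use less.prems in simp)
qed

lemma rc_le_card:
  assumes "card V \<ge> 2"
  shows "rc V E \<le> card V - 1"
proof -
  obtain u where "u \<in> V" using assms by fastforce
  then have "connected_set E V" using connected_set_extend[OF connected_set.singleton] by blast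
  then have "rainbow_colourable V E (card V - 1)" by (rule connected_set_colourable)
  from rc_le_rainbow_colourable[OF this] show ?thesis using assms by simp
qed

text \<open>Makes the net contribution \<open>degree - 1\<close> of each vertex of \<open>Q\<close>
  nonnegative in the final count.\<close>

lemma degree_pos:
  assumes "card V \<ge> 2" "v \<in> V"
  shows "degree E v \<ge> 1"
proof -
  have "{v} \<noteq> V" using assms(1) by auto
  then obtain w where "v \<in> nbrs E w" using boundary_edge[of "{v}"] assms(2) by auto
  then have "nbrs E v \<noteq> {}" using nbrs_sym by fastforce
  then show ?thesis using finite_nbrs by (simp add: degree_nbrs Suc_le_eq card_gt_0_iff)
qed

subsection \<open>Growing a connected two-step dominating set\<close>

text \<open>The vertices of \<open>I\<close> are the centres of the growth process: each brings itself and its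
  neighbours into the closed neighbourhood of \<open>D\<close>, at a price of three vertices of \<open>D\<close>, except that
  \<open>l\<close> of them cost one vertex less and bring one vertex less. The vertices of \<open>Q\<close> cost one vertex
  and bring all but one of their neighbours.\<close>

definition growth :: "'a set \<Rightarrow> 'a set \<Rightarrow> nat \<Rightarrow> 'a set \<Rightarrow> bool" where
  "growth D I l Q \<longleftrightarrow> connected_set E D \<and> D \<subseteq> V \<and> I \<subseteq> D \<and> Q \<subseteq> D \<and>
    independent_set V E I \<and> independent_set V E Q \<and>
    card D + 2 + l = 3 * card I + card Q \<and>
    (\<Sum>u\<in>I. degree E u + 1) + (\<Sum>u\<in>Q. degree E u) \<le> card (closed_nbhd E D) + card Q + l"

lemma growth_finite:
  assumes "growth D I l Q"
  shows "finite D" "finite I" "finite Q" "finite (closed_nbhd E D)" "D \<noteq> {}"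
proof -
  have D: "D \<subseteq> V" "I \<subseteq> D" "Q \<subseteq> D" "connected_set E D" using assms by (auto simp: growth_def)
  then show "finite D" "D \<noteq> {}" using connected_set_finite by blast+
  then show "finite I" "finite Q" using D finite_subset by blast+
  show "finite (closed_nbhd E D)" using D finite_closed_nbhd by blast
qed

lemma card_lt_card_V:
  assumes "D \<subseteq> V" "x \<in> V" "x \<notin> D"
  shows "card D < card V"
  using assms by (intro psubset_card_mono finite_V) auto

lemma card_closed_nbhd_add:
  assumes "closed_nbhd E D \<subseteq> closed_nbhd E D'" "D' \<subseteq> V"
    and "A \<subseteq> closed_nbhd E D'" "A \<inter> closed_nbhd E D = {}"
  shows "card (closed_nbhd E D) + card A \<le> card (closed_nbhd E D')"
proof -
  have fin: "finite (closed_nbhd E D')" using finite_closed_nbhd assms(2) .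
  then have "card (closed_nbhd E D \<union> A) = card (closed_nbhd E D) + card A"
    using assms by (intro card_Un_disjoint) (auto intro: finite_subset)
  moreover have "card (closed_nbhd E D \<union> A) \<le> card (closed_nbhd E D')"
    using fin assms by (intro card_mono) auto
  ultimately show ?thesis by simp
qed

text \<open>A boundary edge of the second neighbourhood leads to a vertex \<open>v\<close> at
  distance 3, reached along \<open>x0, x1, x2, v\<close>. No neighbour of \<open>v\<close> lies in
  \<open>closed_nbhd E D\<close>, so \<open>v\<close> and all its neighbours are gained for three
  new vertices of \<open>D\<close>.\<close>

lemma growth_step_far:
  assumes "growth D I l Q" "closed_nbhd E (closed_nbhd E D) \<noteq> V"
  obtains D' I' where "growth D' I' l Q" "D \<subset> D'"
proof -
  note g = assms(1)[unfolded growth_def]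
  note fin = growth_finite[OF assms(1)]
  let ?N = "closed_nbhd E"
  have sub: "D \<subseteq> V" "?N D \<subseteq> V" "?N (?N D) \<subseteq> V" using g closed_nbhd_subset by auto
  have "?N (?N D) \<noteq> {}" using fin(5) closed_nbhd_superset[of D E] closed_nbhd_superset[of "?N D" E] by auto
  then obtain x2 v where v: "x2 \<in> ?N (?N D)" "v \<in> V - ?N (?N D)" "x2 \<in> nbrs E v"
    using boundary_edge sub(3) assms(2) by metis
  have x2: "x2 \<notin> ?N D" using closed_nbhd_notin[of v E "?N D" x2] v by blast
  obtain x1 where x1: "x1 \<in> ?N D" "x1 \<in> nbrs E x2" using closed_nbhdE[OF v(1) x2] .
  have x1D: "x1 \<notin> D" using closed_nbhd_notin[of x2 E D x1] x2 x1 by blast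
  obtain x0 where x0: "x0 \<in> D" "x0 \<in> nbrs E x1" using closed_nbhdE[OF x1(1) x1D] .
  let ?D = "insert v (insert x2 (insert x1 D))"
  have sup: "D \<subseteq> ?N D" "?N D \<subseteq> ?N (?N D)" by (rule closed_nbhd_superset)+
  have new: "x2 \<noteq> x1" "x2 \<notin> D" "v \<noteq> x1" "v \<noteq> x2" "v \<notin> D" "v \<notin> ?N D"
    using x1 x2 v sup by auto
  have vnb: "nbrs E v \<inter> ?N D = {}" using closed_nbhd_notin[of v E "?N D"] v(2) by blast
  have DV: "?D \<subseteq> V" using sub v x1 by auto
  have conn1: "connected_set E (insert x1 D)"
    using connected_set.insert[of E D x1 x0] g x1D x0 by blast
  have conn2: "connected_set E (insert x2 (insert x1 D))"
    using connected_set.insert[OF conn1, of x2 x1] new x1(2) by auto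
  have conn3: "connected_set E ?D"
    using connected_set.insert[OF conn2, of v x2] new v(3) by auto
  have card: "card ?D = card D + 3" using fin(1) new x1D by simp
  have vI: "v \<notin> I" using new g by auto
  have ind: "independent_set V E (insert v I)"
    using independent_set_insert[of I v] g v(2) vnb sup by blast
  have "card (?N D) + card (insert v (nbrs E v)) \<le> card (?N ?D)"
  proof (rule card_closed_nbhd_add)
    show "?N D \<subseteq> ?N ?D" by (rule closed_nbhd_mono) auto
    show "insert v (nbrs E v) \<subseteq> ?N ?D" by (auto simp: closed_nbhd_def)
    show "insert v (nbrs E v) \<inter> ?N D = {}" using vnb new by auto
  qed (rule DV)
  then have gain: "card (?N D) + (degree E v + 1) \<le> card (?N ?D)"
    using finite_nbrs nbrs_irrefl by (simp add: degree_nbrs)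
  have "growth ?D (insert v I) l Q"
    unfolding growth_def using g conn3 DV ind card gain vI fin by auto
  moreover have "D \<subset> ?D" using new by auto
  ultimately show ?thesis using that by blast
qed

lemma growth_two_step_exists:
  "growth D I l Q \<Longrightarrow> \<exists>D I. growth D I l Q \<and> closed_nbhd E (closed_nbhd E D) = V"
proof (induction "card V - card D" arbitrary: D I rule: less_induct)
  case less
  show ?case
  proof (cases "closed_nbhd E (closed_nbhd E D) = V")
    case True
    then show ?thesis using less.prems by blast
  next
    case False
    obtain D' I' where D': "growth D' I' l Q" "D \<subset> D'" using growth_step_far[OF less.prems False] .
    have "card D < card D'" using D' growth_finite(1) psubset_card_mono by blast
    moreover have "card D' \<le> card V" using D'(1) finite_V card_mono by (auto simp: growth_def)
    ultimately show ?thesis using less.hyps[of D' I'] D'(1) by auto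
  qed
qed

text \<open>Two-step domination gives \<open>z\<close> a neighbour \<open>x1\<close> in
  \<open>closed_nbhd E D\<close>, by assumption the only one. Adding \<open>x1\<close> and
  \<open>z\<close> costs two vertices and gains \<open>z\<close> with its other neighbours; raising
  \<open>l\<close> records that both numbers are one less than in a far step.\<close>

lemma growth_step_second:
  assumes "growth D I l Q" "closed_nbhd E (closed_nbhd E D) = V"
    and z: "z \<in> V - closed_nbhd E D" "card (nbrs E z \<inter> closed_nbhd E D) < 2"
  obtains D' I' where "growth D' I' (l + 1) Q" "D \<subset> D'"
proof -
  note g = assms(1)[unfolded growth_def]
  note fin = growth_finite[OF assms(1)]
  let ?N = "closed_nbhd E"
  have sub: "D \<subseteq> V" "?N D \<subseteq> V" "D \<subseteq> ?N D" using g closed_nbhd_subset[of D] closed_nbhd_superset[of D E] by auto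
  obtain x1 where x1: "x1 \<in> ?N D" "x1 \<in> nbrs E z" using closed_nbhdE[of z E "?N D"] z(1) assms(2) by auto
  have x1D: "x1 \<notin> D" using closed_nbhd_notin[of z E D] z x1 by blast
  obtain x0 where x0: "x0 \<in> D" "x0 \<in> nbrs E x1" using closed_nbhdE[OF x1(1) x1D] .
  have only: "nbrs E z \<inter> ?N D = {x1}"
  proof -
    have "card (nbrs E z \<inter> ?N D) \<le> 1" using z(2) by simp
    then show ?thesis using x1 fin(4) by (auto simp: card_le_Suc0_iff_eq)
  qed
  let ?D = "insert z (insert x1 D)"
  have new: "z \<noteq> x1" "z \<notin> D" "z \<notin> ?N D" using x1 z sub by auto
  have DV: "?D \<subseteq> V" using sub z x1 by auto
  have conn1: "connected_set E (insert x1 D)"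
    using connected_set.insert[of E D x1 x0] g x1D x0 by blast
  have conn2: "connected_set E ?D"
    using connected_set.insert[OF conn1, of z x1] new x1(2) by auto
  have card: "card ?D = card D + 2" using fin(1) new x1D by simp
  have zI: "z \<notin> I" using new g by auto
  have "I \<inter> nbrs E z = {}" using g closed_nbhd_notin[of z E D] new by blast
  then have ind: "independent_set V E (insert z I)"
    using independent_set_insert[of I z] g z(1) by blast
  have "card (?N D) + card (insert z (nbrs E z - {x1})) \<le> card (?N ?D)"
  proof (rule card_closed_nbhd_add)
    show "?N D \<subseteq> ?N ?D" by (rule closed_nbhd_mono) auto
    show "insert z (nbrs E z - {x1}) \<subseteq> ?N ?D" by (auto simp: closed_nbhd_def)
    show "insert z (nbrs E z - {x1}) \<inter> ?N D = {}" using only new by auto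
  qed (rule DV)
  moreover have "card (insert z (nbrs E z - {x1})) = degree E z"
    using finite_nbrs nbrs_irrefl x1(2)
    by (simp add: degree_nbrs card_Suc_Diff1 del: card_Diff_insert)
  ultimately have gain: "card (?N D) + degree E z \<le> card (?N ?D)" by simp
  have "growth ?D (insert z I) (l + 1) Q"
    unfolding growth_def using g conn2 DV ind card gain zI fin by auto
  moreover have "D \<subset> ?D" using new by auto
  ultimately show ?thesis using that by blast
qed

text \<open>This is what \<open>rainbow_colourable_two_nbrs\<close> needs to reach the vertices
  outside the closed neighbourhood with two colours.\<close>

definition two_way :: "'a set \<Rightarrow> bool" where
  "two_way D \<longleftrightarrow> (\<forall>z\<in>V - closed_nbhd E D. card (nbrs E z \<inter> closed_nbhd E D) \<ge> 2)"

lemma growth_two_way_exists: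
  "growth D I l Q \<Longrightarrow> closed_nbhd E (closed_nbhd E D) = V \<Longrightarrow>
    \<exists>D I l. growth D I l Q \<and> two_way D"
proof (induction "card V - card D" arbitrary: D I l rule: less_induct)
  case less
  show ?case
  proof (cases "two_way D")
    case True
    then show ?thesis using less.prems by blast
  next
    case False
    then obtain z where z: "z \<in> V - closed_nbhd E D" "card (nbrs E z \<inter> closed_nbhd E D) < 2"
      by (auto simp: two_way_def not_le)
    obtain D' I' where D': "growth D' I' (l + 1) Q" "D \<subset> D'"
      using growth_step_second[OF less.prems z] .
    have "card D < card D'" using D' growth_finite(1) psubset_card_mono by blast
    moreover have D'V: "D' \<subseteq> V" using D'(1) by (simp add: growth_def)
    moreover have "card D' \<le> card V" using D'V finite_V card_mono by auto
    \<comment> \<open>Two-step domination passes to the larger set, so the next step again finds its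
      neighbour \<open>x1\<close>.\<close>
    moreover have "closed_nbhd E (closed_nbhd E D') = V"
      using less.prems(2) closed_nbhd_mono[of D D'] D'(2) closed_nbhd_subset[OF D'V]
      by (metis closed_nbhd_mono closed_nbhd_subset psubsetE subset_antisym)
    ultimately show ?thesis using less.hyps[of D' I' "l + 1"] D'(1) by auto
  qed
qed

text \<open>The last condition keeps \<open>Q\<close> independent: a vertex that is about to join \<open>Q\<close> has at most one
  neighbour in the closed neighbourhood of \<open>D\<close>.\<close>

lemma growth_final_exists:
  "growth D I l Q \<Longrightarrow> two_way D \<Longrightarrow>
    (\<And>q w. q \<in> Q \<Longrightarrow> w \<in> nbrs E q - D \<Longrightarrow> card (nbrs E w \<inter> closed_nbhd E D) \<ge> 2) \<Longrightarrow>
    \<exists>D Q. growth D I l Q \<and> two_way D \<and>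
      (\<forall>x\<in>closed_nbhd E D - D. card (nbrs E x \<inter> closed_nbhd E D) \<ge> 2)"
proof (induction "card V - card D" arbitrary: D Q rule: less_induct)
  case less
  let ?N = "closed_nbhd E"
  show ?case
  proof (cases "\<forall>x\<in>?N D - D. card (nbrs E x \<inter> ?N D) \<ge> 2")
    case True
    then show ?thesis using less.prems by blast
  next
    case False
    note g = less.prems(1)[unfolded growth_def]
    note fin = growth_finite[OF less.prems(1)]
    obtain x where x: "x \<in> ?N D - D" "card (nbrs E x \<inter> ?N D) < 2" using False by (auto simp: not_le)
    have sub: "D \<subseteq> V" "?N D \<subseteq> V" "D \<subseteq> ?N D" using g closed_nbhd_subset[of D] closed_nbhd_superset[of D E] by auto
    obtain d where d: "d \<in> D" "d \<in> nbrs E x" using closed_nbhdE[of x E D] x by auto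
    have only: "nbrs E x \<inter> ?N D = {d}"
    proof -
      have "card (nbrs E x \<inter> ?N D) \<le> 1" using x(2) by simp
      then show ?thesis using d sub fin(4) by (auto simp: card_le_Suc0_iff_eq)
    qed
    let ?D = "insert x D"
    have DV: "?D \<subseteq> V" using sub x by auto
    have mono: "?N D \<subseteq> ?N ?D" by (rule closed_nbhd_mono) auto
    have fin': "finite (?N ?D)" using finite_closed_nbhd DV .
    have conn: "connected_set E ?D" using connected_set.insert[of E D x d] g x d by auto
    have card: "card ?D = card D + 1" using fin(1) x by simp
    have xQ: "x \<notin> Q" using x g by auto
    have "Q \<inter> nbrs E x = {}"
    proof (rule ccontr)
      assume "Q \<inter> nbrs E x \<noteq> {}"
      then obtain q where "q \<in> Q" "x \<in> nbrs E q - D" using x nbrs_sym by fastforce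
      then show False using less.prems(3) x(2) by fastforce
    qed
    then have ind: "independent_set V E (insert x Q)"
      using independent_set_insert[of Q x] g DV by blast
    \<comment> \<open>All neighbours of \<open>x\<close> except \<open>d\<close> are new, so one
      vertex of \<open>D\<close> buys \<open>degree E x - 1\<close> vertices.\<close>
    have "card (?N D) + card (nbrs E x - {d}) \<le> card (?N ?D)"
    proof (rule card_closed_nbhd_add[OF mono DV])
      show "nbrs E x - {d} \<subseteq> ?N ?D" by (auto simp: closed_nbhd_def)
      show "(nbrs E x - {d}) \<inter> ?N D = {}" using only by auto
    qed
    moreover have "card (nbrs E x - {d}) + 1 = degree E x"
      using finite_nbrs d(2) by (metis Suc_eq_plus1 card_Suc_Diff1 degree_nbrs)
    ultimately have gain: "card (?N D) + degree E x \<le> card (?N ?D) + 1" by simp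
    have "growth ?D I l (insert x Q)"
      unfolding growth_def using g conn DV ind card gain xQ fin by auto
    moreover have "two_way ?D"
      unfolding two_way_def
    proof
      fix z assume "z \<in> V - ?N ?D"
      then have "card (nbrs E z \<inter> ?N D) \<ge> 2"
        using less.prems(2) mono by (auto simp: two_way_def)
      then show "card (nbrs E z \<inter> ?N ?D) \<ge> 2"
        using two_nbrs_transfer fin(4) mono fin' by blast
    qed
    moreover have "card (nbrs E w \<inter> ?N ?D) \<ge> 2"
      if qw: "q \<in> insert x Q" "w \<in> nbrs E q - ?D" for q w
    proof -
      \<comment> \<open>For \<open>q = x\<close>, the neighbour \<open>w\<close> differs from
        \<open>d\<close>, hence lies outside \<open>closed_nbhd E D\<close>, and
        \<open>two_way D\<close> applies; for older \<open>q\<close> the invariant does.\<close>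
      have "card (nbrs E w \<inter> ?N D) \<ge> 2"
      proof (cases "q = x")
        case True
        then have "w \<in> nbrs E x" "w \<noteq> d" using qw(2) d(1) by auto
        then have "w \<notin> ?N D" "w \<in> V" using only nbrs_subset by blast+
        then show ?thesis using less.prems(2) by (auto simp: two_way_def)
      next
        case False
        then show ?thesis using less.prems(3) qw by auto
      qed
      then show ?thesis using two_nbrs_transfer fin(4) mono fin' by blast
    qed
    moreover have "card V - card ?D < card V - card D"
      using card card_lt_card_V[of D x] sub x by auto
    ultimately show ?thesis using less.hyps[of ?D "insert x Q"] by blast
  qed
qed

lemma growth_exists:
  obtains D I l Q where "growth D I l Q" "two_way D"
    "\<And>x. x \<in> closed_nbhd E D - D \<Longrightarrow> card (nbrs E x \<inter> closed_nbhd E D) \<ge> 2"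
proof -
  have "V \<noteq> {}" using conn by (simp add: connected_graph_def)
  then obtain u where u: "u \<in> V" by blast
  have "closed_nbhd E {u} = insert u (nbrs E u)" by (auto simp: closed_nbhd_def)
  then have "card (closed_nbhd E {u}) = degree E u + 1"
    using finite_nbrs nbrs_irrefl by (simp add: degree_nbrs)
  \<comment> \<open>The first centre costs one vertex of \<open>D\<close> instead of three; the 2 in
    \<open>card D + 2 + l\<close> makes up for it.\<close>
  then have "growth {u} {u} 0 {}"
    using u by (auto simp: growth_def independent_set_def connected_set.singleton)
  then obtain D I where "growth D I 0 {}" "closed_nbhd E (closed_nbhd E D) = V"
    using growth_two_step_exists by metis
  then obtain D I l where "growth D I l {}" "two_way D"
    using growth_two_way_exists by metis
  \<comment> \<open>\<open>Q\<close> is still empty, so the condition on its neighbours holds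
    vacuously at the start.\<close>
  then have "\<exists>D Q. growth D I l Q \<and> two_way D \<and>
      (\<forall>x\<in>closed_nbhd E D - D. card (nbrs E x \<inter> closed_nbhd E D) \<ge> 2)"
    by (rule growth_final_exists) simp
  then obtain D Q where "growth D I l Q" "two_way D"
    "\<forall>x\<in>closed_nbhd E D - D. card (nbrs E x \<inter> closed_nbhd E D) \<ge> 2"
    by metis
  then show ?thesis using that[of D I l Q] by simp
qed

section \<open>Colouring the graph around the grown set\<close>

lemma rc_le_growth:
  assumes "growth D I l Q" "two_way D" "card V \<ge> 2"
    and two: "\<And>x. x \<in> closed_nbhd E D - D \<Longrightarrow> card (nbrs E x \<inter> closed_nbhd E D) \<ge> 2"
  shows "rc V E \<le> card D + 2 + min 2 (card V - card (closed_nbhd E D))"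
proof -
  let ?W = "closed_nbhd E D"
  let ?Z = "V - ?W"
  note fin = growth_finite[OF assms(1)]
  have D: "connected_set E D" "D \<subseteq> V" using assms(1) by (auto simp: growth_def)
  have W: "?W = D \<union> (?W - D)" "?W \<subseteq> V" "D \<subseteq> ?W"
    using closed_nbhd_superset[of D E] closed_nbhd_subset[OF D(2)] by auto
  have "rainbow_colourable (D \<union> (?W - D)) E (card D - 1 + 3)"
  proof (rule rainbow_colourable_dominated[OF connected_set_colourable[OF D(1)]])
    show "nbrs E x \<inter> D \<noteq> {}" if "x \<in> ?W - D" for x
      using closed_nbhdE[of x E D] that by blast
    show "card (nbrs E x \<inter> (D \<union> (?W - D))) \<ge> 2" if "x \<in> ?W - D" for x
      using two[OF that] W(1) by simp
  qed (use fin nbrs_irrefl in auto)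
  \<comment> \<open>Subtraction is on naturals: \<open>D\<close> has to be nonempty.\<close>
  moreover have "card D - 1 + 3 = card D + 2" using fin by (simp add: card_gt_0_iff Suc_diff_le)
  ultimately have base: "rainbow_colourable ?W E (card D + 2)" using W(1) by simp
  have m: "card ?Z = card V - card ?W" using fin W(2) by (simp add: card_Diff_subset)
  have nb: "card (nbrs E z \<inter> ?W) \<ge> 2" if "z \<in> ?Z" for z
    using assms(2) that by (auto simp: two_way_def)
  have "rainbow_colourable V E (card D + 2 + min 2 (card ?Z))"
  proof -
    consider "card ?Z = 0" | "card ?Z = 1" | "card ?Z \<ge> 2" by linarith
    then show ?thesis
    proof cases
      case 1
      then have "?W = V" using finite_V W(2) by auto
      then show ?thesis using base by simp
    next
      case 2
      \<comment> \<open>A single remaining vertex is attached by one edge of one new colour, which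
        saves the second colour.\<close>
      then obtain z where z: "?Z = {z}" by (auto simp: card_1_singleton_iff)
      then have zW: "z \<notin> ?W" "V = insert z ?W" using W(2) by auto
      have "card (nbrs E z \<inter> ?W) \<ge> 2" by (rule nb) (simp add: z)
      then have "nbrs E z \<inter> ?W \<noteq> {}" by (metis card.empty not_numeral_le_zero)
      then obtain w where "w \<in> nbrs E z \<inter> ?W" by blast
      then have "rainbow_colourable (insert z ?W) E (card D + 2 + 1)"
        using rainbow_colourable_insert[OF base zW(1)] by blast
      then show ?thesis using 2 zW(2) by simp
    next
      case 3
      have "rainbow_colourable (?W \<union> ?Z) E (card D + 2 + 2)"
        by (rule rainbow_colourable_two_nbrs[OF base]) (use nb in auto)
      moreover have "?W \<union> ?Z = V" using W(2) by blast
      ultimately show ?thesis using 3 by (simp add: min_def)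
    qed
  qed
  then show ?thesis using rc_le_rainbow_colourable m by fastforce
qed

end

section \<open>The numerical estimate and its application\<close>

text \<open>\<open>i\<close>, \<open>q\<close>, \<open>dD\<close> are the sizes of \<open>I\<close>,
  \<open>Q\<close>, \<open>D\<close>; \<open>SI\<close> sums \<open>degree + 1\<close> over
  \<open>I\<close>, \<open>SQ\<close> sums degrees over \<open>Q\<close>, and \<open>m\<close>
  counts the vertices outside \<open>closed_nbhd E D\<close>. The disjunctions arise because
  averaging needs at least \<open>k\<close> vertices.\<close>

lemma growth_arithmetic:
  fixes i q l n m k SI SQ dD r s :: real
  assumes s: "s \<ge> 3" and k: "k \<ge> 1" and nonneg: "l \<ge> 0"
    and I: "i * s \<le> SI \<or> i \<le> k - 1" "SI \<ge> 0"
    and Q: "q * (s - 1) \<le> SQ \<or> q \<le> k - 1" "SQ \<ge> q" "q \<ge> 0"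
    and size: "dD + 2 + l = 3 * i + q" and cover: "SI + SQ \<le> n - m + q + l"
    and r: "r \<le> dD + 2 + min 2 m"
  shows "r \<le> 3 * ((n - 2) / s) + 6 * k - 4"
proof -
  \<comment> \<open>Splitting \<open>n - m\<close> as \<open>(n - 2) + (2 - m)\<close> isolates the
    main term \<open>x\<close>; \<open>y\<close> is later traded against
    \<open>min 2 m\<close>.\<close>
  define a b x y where "a = SI / s" and "b = (SQ - q) / s" and "x = (n - 2) / s"
    and "y = (2 - m) / s"
  have "3 * i \<le> 3 * a + 3 * (k - 1)"
  proof (cases "i * s \<le> SI")
    case True
    then have "i \<le> a" using s by (simp add: a_def field_simps)
    then show ?thesis using k by simp
  next
    case False
    moreover have "a \<ge> 0" using I(2) s by (simp add: a_def)
    ultimately show ?thesis using I(1) by simp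
  qed
  moreover have "q \<le> 3 * b + (k - 1)"
  proof (cases "q * (s - 1) \<le> SQ")
    case True
    \<comment> \<open>For \<open>s \<ge> 3\<close>, \<open>s - 2\<close> is at least
      \<open>s / 3\<close>: vertices of \<open>Q\<close> cost a third of a centre and can afford the
      smaller gain.\<close>
    have "q * s \<le> 3 * (q * (s - 2))"
      using mult_nonneg_nonneg[OF Q(3), of "2 * s - 6"] s by (simp add: algebra_simps)
    also have "\<dots> \<le> 3 * (SQ - q)" using True by (simp add: algebra_simps)
    finally have "q \<le> 3 * b" using s by (simp add: b_def field_simps)
    then show ?thesis using k by simp
  next
    case False
    moreover have "b \<ge> 0" using Q(2) s by (simp add: b_def)
    ultimately show ?thesis using Q(1) by simp
  qed
  moreover have "a + b \<le> x + y + l / s"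
    using cover s by (simp add: a_def b_def x_def y_def add_divide_distrib[symmetric] divide_right_mono)
  \<comment> \<open>The \<open>l\<close> vertices saved in \<open>D\<close> pay for the
    \<open>l\<close> missing from the cover, which weigh \<open>3 / s \<le> 1\<close> each.\<close>
  moreover have "3 * (l / s) \<le> l"
    using mult_nonneg_nonneg[OF nonneg, of "s - 3"] s by (simp add: field_simps)
  ultimately have *: "dD + 2 \<le> 3 * x + 3 * y + 4 * (k - 1)"
    using size by argo
  \<comment> \<open>Each of the first two vertices left outside costs one colour but lowers
    \<open>3 * y\<close> by \<open>3 / s \<le> 1\<close>; for \<open>m > 2\<close>, \<open>y\<close>
    is not positive.\<close>
  have "3 * y + min 2 m \<le> 2"
  proof (cases "m \<le> 2")
    case True
    have "3 * y \<le> 2 - m"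
      using mult_nonneg_nonneg[of "2 - m" "s - 3"] True s by (simp add: y_def field_simps)
    then show ?thesis using True by simp
  next
    case False
    then have "y \<le> 0" using s by (simp add: y_def divide_nonpos_pos)
    then show ?thesis using False by simp
  qed
  \<comment> \<open>The estimates give \<open>3 * x + 4 * k - 2\<close>, which equals the claim for
    \<open>k = 1\<close> and is below it for larger \<open>k\<close>.\<close>
  then have "r \<le> 3 * x + 6 * k - 4" using * r k by argo
  then show ?thesis by (simp add: x_def)
qed

theorem theorem6:
  fixes V :: "'a set" and E :: "'a set set" and k n :: nat
  assumes "simple_graph V E"
    and "connected_graph V E"
    and "card V = n"
    and "n \<ge> 2"
    and "k \<ge> 1"
    and "\<exists>S. independent_set V E S \<and> card S = k"
  shows "real (rc V E) \<le>
    3 * real k * ((real n - 2) / (real (sigma k V E) + real k)) + 6 * real k - 4"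
proof -
  interpret connected_graph_loc V E by unfold_locales (rule assms)+
  \<comment> \<open>By \<open>avg\<close>, \<open>s\<close> bounds from below the mean of
    \<open>degree + 1\<close> over every independent set of at least \<open>k\<close>
    vertices.\<close>
  define s where "s = (real (sigma k V E) + real k) / real k"
  have k: "real k \<ge> 1" using assms(5) by simp
  have bound: "3 * real k * ((real n - 2) / (real (sigma k V E) + real k)) = 3 * ((real n - 2) / s)"
    using k by (simp add: s_def)
  have s: "s > 0" using k by (simp add: s_def add_nonneg_pos)
  have avg: "real (card S) * s \<le> (\<Sum>u\<in>S. real (degree E u) + 1)"
    if "independent_set V E S" "card S \<ge> k" for S
  proof -
    have "real (card S * sigma k V E) \<le> real (k * (\<Sum>u\<in>S. degree E u))"
      using sigma_average[OF that assms(5)] by (simp only: of_nat_le_iff)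
    then show ?thesis using k by (simp add: s_def field_simps sum.distrib)
  qed
  show ?thesis
  proof (cases "s < 3")
    case True
    \<comment> \<open>The main term is then at least \<open>n - 2\<close>, and
      \<open>6 * k - 4 \<ge> 2\<close> covers the missing 1.\<close>
    have "(real n - 2) * s \<le> (real n - 2) * 3"
      using True assms(4) by (intro mult_left_mono) auto
    then have "real n - 2 \<le> 3 * ((real n - 2) / s)" using s by (simp add: field_simps)
    moreover have "real (rc V E) \<le> real n - 1" using rc_le_card assms(3,4) by simp
    ultimately show ?thesis using bound k by linarith
  next
    case False
    obtain D I l Q where G: "growth D I l Q" "two_way D"
      "\<And>x. x \<in> closed_nbhd E D - D \<Longrightarrow> card (nbrs E x \<inter> closed_nbhd E D) \<ge> 2"
      by (rule growth_exists) blast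
    note g = G(1)[unfolded growth_def]
    define m where "m = n - card (closed_nbhd E D)"
    have "card (closed_nbhd E D) \<le> n"
      using card_mono[OF finite_V closed_nbhd_subset[of D]] g assms(3) by simp
    then have m: "real (card (closed_nbhd E D)) = real n - real m" by (simp add: m_def)
    have "real (rc V E) \<le> 3 * ((real n - 2) / s) + 6 * real k - 4"
    proof (rule growth_arithmetic)
      show "real (card I) * s \<le> (\<Sum>u\<in>I. real (degree E u) + 1) \<or> real (card I) \<le> real k - 1"
        using avg[of I] g assms(5) by linarith
      \<comment> \<open>Here degrees are summed without the \<open>+ 1\<close>, hence
        \<open>s - 1\<close>.\<close>
      show "real (card Q) * (s - 1) \<le> (\<Sum>u\<in>Q. real (degree E u)) \<or> real (card Q) \<le> real k - 1"
        using avg[of Q] g assms(5) by (cases "card Q \<ge> k") (auto simp: sum.distrib algebra_simps)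
      have "real (degree E u) \<ge> 1" if "u \<in> Q" for u
        using degree_pos assms(3,4) g that by (metis of_nat_1 of_nat_mono subsetD)
      then show "real (card Q) \<le> (\<Sum>u\<in>Q. real (degree E u))"
        using sum_mono[of Q "\<lambda>_. 1::real"] by simp
      show "real (card D) + 2 + real l = 3 * real (card I) + real (card Q)"
        using g by linarith
      have "real ((\<Sum>u\<in>I. degree E u + 1) + (\<Sum>u\<in>Q. degree E u)) \<le>
          real (card (closed_nbhd E D) + card Q + l)"
        using g by (simp only: of_nat_le_iff)
      then show "(\<Sum>u\<in>I. real (degree E u) + 1) + (\<Sum>u\<in>Q. real (degree E u)) \<le>
          real n - real m + real (card Q) + real l"
        using m by (simp add: add.commute)
      have "rc V E \<le> card D + 2 + min 2 m"
        using rc_le_growth[OF G(1,2) _ G(3)] assms(3,4) by (simp add: m_def)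
      then show "real (rc V E) \<le> real (card D) + 2 + min 2 (real m)"
        by (simp add: min_def split: if_splits)
    qed (use False k in \<open>auto intro: sum_nonneg\<close>)
    then show ?thesis using bound by simp
  qed
qed

end
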